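(* Let $j\ge 1$ and let $G$ be a connected graph on at least two vertices with independence number $\alpha(G)$. Let $\mu_j(G)$ be the $j$-th power mean of the multiset of distances $\{d(u,v)\}_{\{u,v\}\subset V(G)}$ over all unordered pairs of distinct vertices. Then $\mu_j(G)\le \mathrm{M}_j(2\alpha(G)-1,1)=\left(\frac{(2\alpha(G)-1)^j+1}{2}\right)^{1/j}$.
   Context: For positive reals $x_1,\dots,x_N$, the $j$-th power mean is $\mathrm{M}_j(x_1,\dots,x_N)=\left(\frac{x_1^j+\dots+x_N^j}{N}\right)^{1/j}$. $d(u,v)$ is the graph distance; the independence number is the size of a largest independent vertex set. *)

theory Defs
  imports Complex_Main "HOL-Library.Multiset" "Graph_Theory.Graph_Theory"
begin

text \<open>
  Finite simple graphs are the loop-free symmetric finite digraphs without parallel arcs of the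
  locale \<^locale>\<open>graph\<close>; each undirected edge is represented by its two orientations.
\<close>

definition graph_dist :: "('a, 'b) pre_digraph \<Rightarrow> 'a \<Rightarrow> 'a \<Rightarrow> nat" where
  "graph_dist G u v = (LEAST n. \<exists>p. pre_digraph.awalk G u p v \<and> length p = n)"

definition pair_dist :: "('a, 'b) pre_digraph \<Rightarrow> 'a set \<Rightarrow> nat" where
  "pair_dist G e = (THE n. \<exists>u v. e = {u, v} \<and> n = graph_dist G u v)"

definition independent_set :: "('a, 'b) pre_digraph \<Rightarrow> 'a set \<Rightarrow> bool" where
  "independent_set G S \<longleftrightarrow> S \<subseteq> verts G \<and> (\<forall>u\<in>S. \<forall>v\<in>S. \<not> u \<rightarrow>\<^bsub>G\<^esub> v)"

definition independence_number :: "('a, 'b) pre_digraph \<Rightarrow> nat" where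
  "independence_number G = Max (card ` {S. independent_set G S})"

definition power_mean :: "real \<Rightarrow> real multiset \<Rightarrow> real" where
  "power_mean j X = ((\<Sum>x\<in>#X. x powr j) / real (size X)) powr (1 / j)"

definition distance_mset :: "('a, 'b) pre_digraph \<Rightarrow> real multiset" where
  "distance_mset G =
     image_mset (\<lambda>e. real (pair_dist G e)) (mset_set {e. e \<subseteq> verts G \<and> card e = 2})"

definition mean_distance :: "real \<Rightarrow> ('a, 'b) pre_digraph \<Rightarrow> real" where
  "mean_distance j G = power_mean j (distance_mset G)"

text \<open>
  In a symmetric digraph the distance is symmetric, so \<^const>\<open>pair_dist\<close> is well defined on
  unordered pairs.
\<close>

lemma (in sym_digraph) awalk_reverse:
  "awalk u p v \<Longrightarrow> \<exists>q. awalk v q u \<and> length q = length p"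
proof (induction p arbitrary: u)
  case Nil
  then show ?case by (auto simp: awalk_Nil_iff)
next
  case (Cons a p)
  then have a: "a \<in> arcs G" "u = tail G a" and p: "awalk (head G a) p v"
    by (auto simp: awalk_Cons_iff)
  from Cons.IH[OF p] obtain q where q: "awalk v q (head G a)" "length q = length p" by blast
  have "tail G a \<rightarrow>\<^bsub>G\<^esub> head G a" using a by (auto simp: arcs_ends_def arc_to_ends_def)
  then have "head G a \<rightarrow>\<^bsub>G\<^esub> tail G a"
    using sym_arcs by (auto simp: symmetric_def dest: symD)
  then obtain b where b: "b \<in> arcs G" "tail G b = head G a" "head G b = tail G a"
    by (auto simp: arcs_ends_def arc_to_ends_def)
  have "awalk (head G a) [b] u"
    using b a by (auto simp: awalk_Cons_iff awalk_Nil_iff)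
  with q have "awalk v (q @ [b]) u" by (auto simp: awalk_append_iff)
  with q show ?case by (intro exI[of _ "q @ [b]"]) simp
qed

lemma (in sym_digraph) graph_dist_commute: "graph_dist G u v = graph_dist G v u"
  unfolding graph_dist_def by (rule arg_cong[where f = Least]) (use awalk_reverse in \<open>metis\<close>)

lemma (in sym_digraph) pair_dist_eq: "pair_dist G {u, v} = graph_dist G u v"
  unfolding pair_dist_def
  by (rule the_equality) (auto simp: doubleton_eq_iff graph_dist_commute)

end

theory Submission
  imports Defs "HOL-Analysis.Convex"
begin

text \<open>
  By convexity of \<^term>\<open>\<lambda>x::real. x powr j\<close> on \<open>[1, 2\<alpha> - 1]\<close>, which contains all distances since every
  second vertex of a geodesic gives an independent set, the theorem reduces to \<open>j = 1\<close>: the mean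
  distance is at most \<open>\<alpha>\<close> (F. Chung).

  For \<open>j = 1\<close> we prove a version with vertex multiplicities, in which two copies of a vertex have
  distance 1, so that the sum over ordered pairs (including the diagonal) must be at most
  \<open>\<alpha>n\<^sup>2 - (\<alpha> - 1)n\<close>. Moving copies between adjacent vertices changes this sum linearly. Hence if
  two non-cut vertices are adjacent, all copies of one of them can be moved to the other without
  decreasing the sum, and the empty vertex can be deleted. Otherwise the non-cut vertices are
  independent, and then a breadth-first search from a non-cut vertex finds in its last two layers a
  vertex \<open>u\<close> with a nonempty set \<open>P\<close> of pendant neighbours such that deleting \<open>u\<close> and \<open>P\<close> keeps the
  graph connected. The deletion lowers \<open>\<alpha>\<close> by at least \<open>|P|\<close>, and when all copies of deleted
  vertices are moved to another neighbour of \<open>u\<close>, the sum drops by at most \<open>|P|(n\<^sup>2 - n)\<close>.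
\<close>

section \<open>Walks and distances in induced subgraphs\<close>

locale adjacency =
  fixes adj :: "'a \<Rightarrow> 'a \<Rightarrow> bool"
  assumes adj_sym: "adj x y \<Longrightarrow> adj y x"
    and adj_irrefl: "\<not> adj x x"
begin

text \<open>Adjacency in the subgraph induced on \<open>U\<close>. Deleting vertices only shrinks
  \<open>U\<close>, so no new graph has to be built.\<close>

definition step :: "'a set \<Rightarrow> 'a \<Rightarrow> 'a \<Rightarrow> bool" where
  "step U x y \<longleftrightarrow> x \<in> U \<and> y \<in> U \<and> adj x y"

definition conn :: "'a set \<Rightarrow> bool" where
  "conn U \<longleftrightarrow> (\<forall>x\<in>U. \<forall>y\<in>U. (step U)\<^sup>*\<^sup>* x y)"

definition dst :: "'a set \<Rightarrow> 'a \<Rightarrow> 'a \<Rightarrow> nat" where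
  "dst U x y = (LEAST n. (step U ^^ n) x y)"

text \<open>On the diagonal, \<open>cdist\<close> is the distance of two adjacent copies of the same vertex.\<close>

definition cdist :: "'a set \<Rightarrow> 'a \<Rightarrow> 'a \<Rightarrow> int" where
  "cdist U x y = (if x = y then 1 else int (dst U x y))"

definition indep :: "'a set \<Rightarrow> bool" where
  "indep S \<longleftrightarrow> (\<forall>x\<in>S. \<forall>y\<in>S. \<not> adj x y)"

lemma step_sym: "step U x y \<Longrightarrow> step U y x"
  by (auto simp: step_def adj_sym)

lemma step_mono: "U' \<subseteq> U \<Longrightarrow> step U' x y \<Longrightarrow> step U x y"
  by (auto simp: step_def)

lemma relpowp_step_sym: "(step U ^^ n) x y \<Longrightarrow> (step U ^^ n) y x"
proof (induction n arbitrary: y)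
  case (Suc n)
  then obtain z where "(step U ^^ n) x z" "step U z y" by auto
  then show ?case by (metis Suc.IH relpowp_Suc_I2 step_sym)
qed auto

lemma reach_sym: "(step U)\<^sup>*\<^sup>* x y \<Longrightarrow> (step U)\<^sup>*\<^sup>* y x"
  by (metis relpowp_step_sym rtranclp_imp_relpowp relpowp_imp_rtranclp)

lemma dst_walk: "(step U)\<^sup>*\<^sup>* x y \<Longrightarrow> (step U ^^ dst U x y) x y"
  unfolding dst_def by (metis LeastI rtranclp_imp_relpowp)

lemma dst_le: "(step U ^^ n) x y \<Longrightarrow> dst U x y \<le> n"
  unfolding dst_def by (rule Least_le)

lemma dst_commute: "dst U x y = dst U y x"
  unfolding dst_def by (rule arg_cong[where f = Least]) (use relpowp_step_sym in blast)

lemma dst_self [simp]: "dst U x x = 0"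
  using dst_le[of 0 U x x] by simp

lemma cdist_commute: "cdist U x y = cdist U y x"
  by (simp add: cdist_def dst_commute)

lemma cdist_self [simp]: "cdist U x x = 1"
  by (simp add: cdist_def)

lemma connD: "conn U \<Longrightarrow> x \<in> U \<Longrightarrow> y \<in> U \<Longrightarrow> (step U)\<^sup>*\<^sup>* x y"
  by (auto simp: conn_def)

lemma connI_root: "(\<And>y. y \<in> U \<Longrightarrow> (step U)\<^sup>*\<^sup>* r y) \<Longrightarrow> conn U"
  unfolding conn_def by (meson reach_sym rtranclp_trans)

text \<open>A shortest walk inside \<open>U'\<close> is also a walk inside \<open>U\<close>;
  \<open>conn U'\<close> guarantees that one exists.\<close>

lemma dst_antimono:
  assumes "U' \<subseteq> U" "conn U'" "x \<in> U'" "y \<in> U'"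
  shows "dst U x y \<le> dst U' x y"
  using relpowp_mono[OF step_mono[OF assms(1)] dst_walk[OF connD[OF assms(2-)]]] by (rule dst_le)

lemma cdist_antimono:
  assumes "U' \<subseteq> U" "conn U'" "x \<in> U'" "y \<in> U'"
  shows "cdist U x y \<le> cdist U' x y"
  using dst_antimono[OF assms] by (simp add: cdist_def)

lemma dst_triangle:
  assumes "conn U" "x \<in> U" "y \<in> U" "z \<in> U"
  shows "dst U x z \<le> dst U x y + dst U y z"
  by (meson assms connD dst_le dst_walk relpowp_trans)

lemma dst_adj_le: "x \<in> U \<Longrightarrow> y \<in> U \<Longrightarrow> adj x y \<Longrightarrow> dst U x y \<le> 1"
  by (rule dst_le) (auto simp: step_def)

lemma dst_eq_0_iff:
  assumes "conn U" "x \<in> U" "y \<in> U"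
  shows "dst U x y = 0 \<longleftrightarrow> x = y"
  using dst_walk[OF connD[OF assms]] by auto

lemma cdist_adj:
  assumes "conn U" "x \<in> U" "y \<in> U" "adj x y"
  shows "cdist U x y = 1"
  using dst_adj_le[OF assms(2-)] dst_eq_0_iff[OF assms(1-3)] adj_irrefl assms(4)
  by (auto simp: cdist_def)

text \<open>Take for \<open>z\<close> the last vertex before \<open>y\<close> on a shortest walk
  from \<open>r\<close>; if it were nearer to \<open>r\<close> than claimed, so would be
  \<open>y\<close>.\<close>

lemma dst_predecessor:
  assumes "conn U" "r \<in> U" "y \<in> U" "r \<noteq> y"
  obtains z where "z \<in> U" "adj z y" "dst U r y = Suc (dst U r z)"
proof -
  obtain n where n: "dst U r y = Suc n"
    using dst_eq_0_iff[OF assms(1-3)] assms(4) not0_implies_Suc by blast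
  then obtain z where z: "(step U ^^ n) r z" "step U z y"
    using dst_walk[OF connD[OF assms(1-3)]] by auto
  have "z \<in> U" "adj z y" using z(2) by (auto simp: step_def)
  moreover have "dst U r z \<le> n" using z(1) by (rule dst_le)
  moreover have "dst U r y \<le> dst U r z + 1"
    using dst_triangle[of U r z y] dst_adj_le[of z U y] assms calculation by linarith
  ultimately show ?thesis using that n by force
qed

section \<open>Connectedness after deleting vertices\<close>

text \<open>Each predecessor is strictly nearer to \<open>r\<close>, so the descent from
  \<open>y\<close> never meets \<open>X\<close>, whose vertices are all at least as far from
  \<open>r\<close> as \<open>y\<close>.\<close>

lemma reach_avoiding:
  assumes "conn U" "r \<in> U"
  shows "y \<in> U - X \<Longrightarrow> \<forall>z\<in>X \<inter> U. dst U r y \<le> dst U r z \<Longrightarrow> (step (U - X))\<^sup>*\<^sup>* r y"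
proof (induction "dst U r y" arbitrary: y)
  case 0
  then show ?case using dst_eq_0_iff assms by auto
next
  case (Suc n)
  then have "r \<noteq> y" by auto
  then obtain z where z: "z \<in> U" "adj z y" "dst U r y = Suc (dst U r z)"
    using dst_predecessor assms Suc.prems by blast
  then have "z \<notin> X" using Suc.prems(2) by (metis IntI not_less_eq_eq order_refl)
  then have "(step (U - X))\<^sup>*\<^sup>* r z" using Suc z by force
  moreover have "step (U - X) z y" using \<open>z \<notin> X\<close> z Suc.prems by (auto simp: step_def)
  ultimately show ?case by simp
qed

lemma conn_delete_farthest:
  assumes "conn U" "r \<in> U" "v \<in> U" "\<And>z. z \<in> U \<Longrightarrow> dst U r z \<le> dst U r v"
  shows "conn (U - {v})"
  by (rule connI_root[where r = r]) (use reach_avoiding[of U r _ "{v}"] assms in auto)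

lemma ex_farthest:
  assumes "finite U" "U \<noteq> {}"
  obtains v where "v \<in> U" "\<And>z. z \<in> U \<Longrightarrow> dst U r z \<le> dst U r v"
proof -
  have fin: "finite (dst U r ` U)" "dst U r ` U \<noteq> {}" using assms by auto
  from Max_in[OF this] obtain v where "v \<in> U" "dst U r v = Max (dst U r ` U)" by auto
  then show ?thesis using that Max_ge[OF fin(1)] by simp
qed

section \<open>Moving copies between vertices\<close>

text \<open>The family \<open>f\<close> lists the vertices with their multiplicities.\<close>

lemma merge_adjacent:
  fixes f :: "'i \<Rightarrow> 'a"
  assumes "conn U" "conn (U - {v})" "u \<in> U" "v \<in> U" "adj u v" "f ` I \<subseteq> U"
    and le: "(\<Sum>k\<in>I. cdist U v (f k)) \<le> (\<Sum>k\<in>I. cdist U u (f k))"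
  defines "g \<equiv> \<lambda>i. if f i = v then u else f i"
  shows "(\<Sum>i\<in>I. \<Sum>k\<in>I. cdist U (f i) (f k)) \<le> (\<Sum>i\<in>I. \<Sum>k\<in>I. cdist (U - {v}) (g i) (g k))"
proof -
  define \<delta> where "\<delta> y = cdist U u y - cdist U v y" for y
  define t :: "'i \<Rightarrow> int" where "t i = of_bool (f i = v)" for i
  \<comment> \<open>Since \<open>cdist\<close> is 1 on the diagonal as well as on the edge
    \<open>u v\<close>, \<open>\<delta>\<close> vanishes at \<open>u\<close> and \<open>v\<close>.
    Hence the change is linear in \<open>t\<close>, with no correction term
    \<open>t i * t k\<close>.\<close>
  have "cdist U u v = 1" using assms cdist_adj by blast
  then have point: "cdist U (g i) (g k) = cdist U (f i) (f k) + (t i * \<delta> (f k) + \<delta> (f i) * t k)" for i k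
    by (auto simp: g_def t_def \<delta>_def cdist_commute)
  have "(\<Sum>i\<in>I. \<Sum>k\<in>I. cdist U (g i) (g k)) = (\<Sum>i\<in>I. \<Sum>k\<in>I. cdist U (f i) (f k)) +
      ((\<Sum>i\<in>I. t i) * (\<Sum>k\<in>I. \<delta> (f k)) + (\<Sum>i\<in>I. \<delta> (f i)) * (\<Sum>k\<in>I. t k))"
    by (simp add: point sum.distrib sum_product)
  moreover have "0 \<le> (\<Sum>k\<in>I. \<delta> (f k))" using le by (simp add: \<delta>_def sum_subtractf)
  moreover have "0 \<le> (\<Sum>k\<in>I. t k)" by (rule sum_nonneg) (simp add: t_def)
  ultimately have "(\<Sum>i\<in>I. \<Sum>k\<in>I. cdist U (f i) (f k)) \<le> (\<Sum>i\<in>I. \<Sum>k\<in>I. cdist U (g i) (g k))"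
    by simp
  also have "\<dots> \<le> (\<Sum>i\<in>I. \<Sum>k\<in>I. cdist (U - {v}) (g i) (g k))"
  proof (intro sum_mono cdist_antimono)
    have "u \<noteq> v" using assms adj_irrefl by blast
    then show "g i \<in> U - {v}" "g k \<in> U - {v}" if "i \<in> I" "k \<in> I" for i k
      using assms that by (auto simp: g_def)
  qed (use assms in auto)
  finally show ?thesis .
qed

text \<open>Through \<open>u\<close>, a vertex of \<open>P\<close> is at most two steps from
  \<open>x\<close>, and \<open>u\<close> itself is one step away. So moving their copies to
  \<open>x\<close> costs each distance to a surviving vertex at most 2 or 1; these losses are summed
  over all pairs of copies.\<close>

lemma collapse_pendants:
  fixes f :: "'i \<Rightarrow> 'a"
  assumes "conn U" "conn U'" and U': "U' = U - insert u P"
    and "u \<in> U" "P \<subseteq> U" "P \<noteq> {}" "finite P" "u \<notin> P" and P: "\<And>s. s \<in> P \<Longrightarrow> adj u s"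
    and "x \<in> U'" "adj x u" "finite I" and f: "f ` I = U"
  defines "g \<equiv> \<lambda>i. if f i \<in> insert u P then x else f i"
  shows "(\<Sum>i\<in>I. \<Sum>k\<in>I. cdist U (f i) (f k)) \<le>
    (\<Sum>i\<in>I. \<Sum>k\<in>I. cdist U' (g i) (g k)) + int (card P) * ((int (card I))\<^sup>2 - int (card I))"
proof -
  define n p :: int where "n = int (card I)" and "p = int (card P)"
  define b :: "'i \<Rightarrow> int" where "b i = of_bool (f i \<in> insert u P)" for i
  define h :: "'i \<Rightarrow> int" where "h i = of_bool (f i = x)" for i
  define c :: "'i \<Rightarrow> int" where "c i = of_bool (f i = u)" for i
  have sub: "U' \<subseteq> U" and xU: "x \<in> U" using assms by auto
  have p1: "p \<ge> 1" using assms by (simp add: p_def Suc_leI card_gt_0_iff)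
  have up: "dst U u y \<le> 1 + dst U' x y" if "y \<in> U'" for y
    using dst_triangle[of U u x y] dst_adj_le[of x U u] dst_antimono[of U' U x y] that sub xU assms
    by (auto simp: dst_commute[of U u x])
  have sp: "dst U s y \<le> 2 + dst U' x y" if "y \<in> U'" "s \<in> P" for y s
    using dst_triangle[of U s u y] dst_adj_le[of u U s] up[of y] that sub assms
    by (auto simp: dst_commute[of U s u])
  \<comment> \<open>The savings matter later: one for \<open>y = x\<close>, because
    \<open>cdist U' x x\<close> is 1 and not 0, and one for \<open>a = u\<close>, which is a step
    nearer to \<open>x\<close>.\<close>
  have mixed: "cdist U a y \<le> cdist U' x y + (2 - of_bool (y = x) - of_bool (a = u))"
    if "a \<in> insert u P" "y \<in> U'" for a y
  proof -
    have "a \<noteq> y" using that U' by auto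
    then show ?thesis using that up[of y] sp[of y a] by (auto simp: cdist_def)
  qed
  \<comment> \<open>Distance 2 occurs only between two distinct members of \<open>P\<close>, and
    then \<open>p\<close> is at least 2.\<close>
  have inner: "cdist U a a' \<le> p" if "a \<in> insert u P" "a' \<in> insert u P" for a a'
  proof (cases "a = a' \<or> a = u \<or> a' = u")
    case True
    have "cdist U u s = 1" if "s \<in> P" for s
      using that assms(1,4,5) P by (intro cdist_adj) auto
    then show ?thesis using True that p1 by (auto simp: cdist_commute[of U _ u])
  next
    case False
    then have "{a, a'} \<subseteq> P" "a \<noteq> a'" using that by auto
    then have "2 \<le> p" using card_mono[of P "{a, a'}"] assms by (simp add: p_def)
    moreover have "a \<in> U" "a' \<in> U" "adj u a" "adj u a'"
      using \<open>{a, a'} \<subseteq> P\<close> \<open>P \<subseteq> U\<close> P by auto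
    then have "dst U a a' \<le> 2"
      using dst_triangle[of U a u a'] dst_adj_le[of u U a] dst_adj_le[of u U a'] \<open>conn U\<close> \<open>u \<in> U\<close>
      by (simp add: dst_commute[of U a u])
    ultimately show ?thesis using False by (simp add: cdist_def)
  qed
  define a where "a i = 1 - b i" for i
  \<comment> \<open>\<open>e i k\<close> bounds the loss of one pair: \<open>p - 1\<close> if both
    copies move, as they end at \<open>cdist\<close> 1; the excess in \<open>mixed\<close> if just
    one moves; and 0 if neither does.\<close>
  define e where "e i k = (p - 1) * (b i * b k) + (2 * (b i * a k) - b i * h k - c i * a k)
      + (2 * (a i * b k) - h i * b k - a i * c k)" for i k
  have xB: "x \<notin> insert u P" using assms by auto
  have point: "cdist U (f i) (f k) \<le> cdist U' (g i) (g k) + e i k" if "i \<in> I" "k \<in> I" for i k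
  proof -
    have fU: "f i \<in> U" "f k \<in> U" using that f by auto
    consider "f i \<in> insert u P" "f k \<in> insert u P" | "f i \<in> insert u P" "f k \<notin> insert u P"
      | "f i \<notin> insert u P" "f k \<in> insert u P" | "f i \<notin> insert u P" "f k \<notin> insert u P" by blast
    then show ?thesis
    proof cases
      case 1
      then have "h i = 0" "h k = 0" "b i = 1" "b k = 1" using xB by (auto simp: h_def b_def)
      then show ?thesis using inner[OF 1] 1 by (simp add: g_def a_def e_def)
    next
      case 2
      then have "b i = 1" "b k = 0" "c k = 0" by (auto simp: c_def b_def)
      then show ?thesis using mixed[of "f i" "f k"] 2 fU U'
        by (simp add: g_def a_def e_def h_def c_def)
    next
      case 3
      then have "b i = 0" "b k = 1" "c i = 0" by (auto simp: c_def b_def)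
      then show ?thesis using mixed[of "f k" "f i"] 3 fU U'
        by (simp add: g_def a_def e_def h_def c_def cdist_commute[of _ "f i"])
    next
      case 4
      then have "b i = 0" "b k = 0" "c i = 0" "c k = 0" by (auto simp: c_def b_def)
      then show ?thesis using cdist_antimono[of U' U "f i" "f k"] 4 fU U' assms
        by (simp add: g_def a_def e_def)
    qed
  qed
  \<comment> \<open>\<open>m\<close>, \<open>X\<close> and \<open>C\<close> are the multiplicities of \<open>insert u P\<close>, \<open>x\<close> and \<open>u\<close>\<close>
  define m X C where "m = (\<Sum>i\<in>I. b i)" and "X = (\<Sum>i\<in>I. h i)" and "C = (\<Sum>i\<in>I. c i)"
  have n: "n = (\<Sum>i\<in>I. 1)" by (simp add: n_def)
  have nm: "n - m = (\<Sum>i\<in>I. a i)" by (simp add: n m_def a_def sum_subtractf)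
  have "(\<Sum>i\<in>I. \<Sum>k\<in>I. e i k) = (p - 1) * (m * m) + (2 * (m * (n - m)) - m * X - C * (n - m))
      + (2 * ((n - m) * m) - X * m - (n - m) * C)"
    unfolding e_def nm unfolding m_def X_def C_def
    by (simp only: sum.distrib sum_subtractf sum_distrib_left[symmetric] sum_distrib_right[symmetric])
  moreover have "X \<ge> 1"
  proof -
    obtain i where "i \<in> I" "f i = x" using f xU by blast
    then show ?thesis unfolding X_def using member_le_sum[of i I h] assms by (simp add: h_def)
  qed
  moreover have "C \<ge> 1"
  proof -
    obtain i where "i \<in> I" "f i = u" using f \<open>u \<in> U\<close> by blast
    then show ?thesis unfolding C_def using member_le_sum[of i I c] assms by (simp add: c_def)
  qed
  moreover have "m \<ge> 0" unfolding m_def by (rule sum_nonneg) (simp add: b_def)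
  moreover have "X \<le> n - m" unfolding X_def nm
    by (rule sum_mono) (use xB in \<open>auto simp: h_def a_def b_def\<close>)
  \<comment> \<open>As \<open>x\<close> and \<open>u\<close> both carry a copy, the negative terms
    amount to at least \<open>2 * n\<close>. With \<open>4 * (m * (n - m)) \<le> n\<^sup>2\<close>
    the mixed pairs lose at most \<open>n\<^sup>2 - 2 * n\<close>, and \<open>m \<le> n - 1\<close>
    settles the inner pairs.\<close>
  moreover have "(p - 1) * (m * m) + (2 * (m * (n - m)) - m * X - C * (n - m))
      + (2 * ((n - m) * m) - X * m - (n - m) * C) \<le> p * (n\<^sup>2 - n)"
    if "X \<ge> 1" "C \<ge> 1" "m \<ge> 0" "X \<le> n - m"
  proof -
    have "m * 1 \<le> m * X" "1 * (n - m) \<le> C * (n - m)"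
      using that by (intro mult_left_mono mult_right_mono; simp)+
    moreover have "4 * (m * (n - m)) \<le> n\<^sup>2"
      using zero_le_power2[of "n - 2 * m"] by (simp add: power2_eq_square algebra_simps)
    moreover have "m * m \<le> n * (n - 1)" using that by (intro mult_mono) auto
    then have "(p - 1) * (m * m) \<le> (p - 1) * (n\<^sup>2 - n)"
      using p1 by (intro mult_left_mono) (auto simp: power2_eq_square algebra_simps)
    ultimately show ?thesis using that by (simp add: algebra_simps)
  qed
  ultimately have "(\<Sum>i\<in>I. \<Sum>k\<in>I. e i k) \<le> p * (n\<^sup>2 - n)" by simp
  moreover have "(\<Sum>i\<in>I. \<Sum>k\<in>I. cdist U (f i) (f k))
      \<le> (\<Sum>i\<in>I. \<Sum>k\<in>I. cdist U' (g i) (g k)) + (\<Sum>i\<in>I. \<Sum>k\<in>I. e i k)"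
    unfolding sum.distrib[symmetric] by (intro sum_mono point)
  ultimately show ?thesis by (simp add: n_def p_def)
qed

section \<open>Pendant vertices in the last layer of a search\<close>

text \<open>Vertices of the last layer are non-cut, hence pairwise non-adjacent by
  \<open>no_adj\<close>, and a neighbour \<open>u\<close> of one of them is a cut vertex. What
  deleting \<open>u\<close> separates can only be last-layer vertices attached to \<open>u\<close>
  alone.\<close>

lemma ex_pendants:
  assumes "finite U" "conn U" "card U \<ge> 2"
    and no_adj: "\<forall>u\<in>U. \<forall>v\<in>U. adj u v \<longrightarrow> conn (U - {u}) \<longrightarrow> \<not> conn (U - {v})"
  obtains u P x where "u \<in> U" "P \<subseteq> U" "P \<noteq> {}" "u \<notin> P" "\<forall>s\<in>P. \<forall>z\<in>U. adj s z \<longleftrightarrow> z = u"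
    "conn (U - insert u P)" "x \<in> U - insert u P" "adj x u"
proof -
  have "U \<noteq> {}" using assms by auto
  then obtain q where "q \<in> U" by blast
  \<comment> \<open>the root must be a non-cut vertex: this is what makes the search at least two layers deep\<close>
  obtain r where r: "r \<in> U" "\<And>z. z \<in> U \<Longrightarrow> dst U q z \<le> dst U q r"
    using ex_farthest[OF assms(1) \<open>U \<noteq> {}\<close>] by blast
  have rc: "conn (U - {r})" using conn_delete_farthest[OF assms(2) \<open>q \<in> U\<close> r] .
  obtain v where v: "v \<in> U" "\<And>z. z \<in> U \<Longrightarrow> dst U r z \<le> dst U r v"
    using ex_farthest[OF assms(1) \<open>U \<noteq> {}\<close>] by blast
  define L where "L = {z \<in> U. dst U r z = dst U r v}"
  have Lc: "conn (U - {z})" if "z \<in> L" for z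
    using that v conn_delete_farthest[OF assms(2) r(1), of z] by (auto simp: L_def)
  have Lind: "\<not> adj y z" if "y \<in> L" "z \<in> L" for y z
    using no_adj Lc that by (auto simp: L_def)
  have "\<exists>z\<in>U. z \<noteq> r" using assms(3) by (metis One_nat_def Suc_1 card_le_Suc0_iff_eq assms(1) not_less_eq_eq)
  then obtain z where "z \<in> U" "z \<noteq> r" by blast
  then have "0 < dst U r v" using v(2)[of z] dst_eq_0_iff[OF assms(2) r(1), of z] by auto
  then have "r \<noteq> v" by auto
  then obtain u where u: "u \<in> U" "adj u v" "dst U r v = Suc (dst U r u)"
    using dst_predecessor[OF assms(2) r(1) v(1)] by blast
  have "conn (U - {v})" using v(1) Lc[of v] by (simp add: L_def)
  \<comment> \<open>As \<open>r\<close> is non-cut and \<open>u\<close> is not, they differ. So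
    \<open>u\<close> has a predecessor \<open>x\<close>, which survives the deletion.\<close>
  then have uc: "\<not> conn (U - {u})" using no_adj u(1,2) v(1) by blast
  then have "u \<noteq> r" using rc by auto
  then obtain x where x: "x \<in> U" "adj x u" "dst U r u = Suc (dst U r x)"
    using dst_predecessor[OF assms(2) r(1) u(1)] by blast
  define P where "P = {s \<in> L. \<forall>z\<in>U. adj s z \<longrightarrow> z = u}"
  \<comment> \<open>Used with \<open>Q = {}\<close> to show that \<open>P\<close> is nonempty
    (otherwise \<open>u\<close> would be non-cut), and with \<open>Q = P\<close> for the final
    connectedness. Vertices below the last layer are no farther than \<open>u\<close>, so they are
    reached by descent; a vertex of \<open>L\<close> is reached through a neighbour other than
    \<open>u\<close>, which lies outside \<open>L\<close>.\<close>
  have reach: "(step (U - insert u Q))\<^sup>*\<^sup>* r y"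
    if "Q \<subseteq> L" and y: "y \<in> U - insert u Q" and nb: "y \<in> L \<Longrightarrow> \<exists>z\<in>U. adj y z \<and> z \<noteq> u" for Q y
  proof -
    have low: "(step (U - insert u Q))\<^sup>*\<^sup>* r z" if "z \<in> U - insert u Q" "z \<notin> L" for z
    proof (rule reach_avoiding[OF assms(2) r(1) that(1)])
      have "dst U r z \<le> dst U r u" using that v(2)[of z] u(3) by (auto simp: L_def)
      then show "\<forall>w\<in>insert u Q \<inter> U. dst U r z \<le> dst U r w"
        using \<open>Q \<subseteq> L\<close> u(3) by (auto simp: L_def)
    qed
    show ?thesis
    proof (cases "y \<in> L")
      case True
      then obtain z where z: "z \<in> U" "adj y z" "z \<noteq> u" using nb by blast
      then have "z \<notin> L" using Lind True by blast
      then have "(step (U - insert u Q))\<^sup>*\<^sup>* r z" using low z \<open>Q \<subseteq> L\<close> by auto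
      moreover have "step (U - insert u Q) z y"
        using z y \<open>z \<notin> L\<close> \<open>Q \<subseteq> L\<close> adj_sym by (auto simp: step_def)
      ultimately show ?thesis by simp
    qed (use low y in auto)
  qed
  have "P \<noteq> {}"
  proof
    assume "P = {}"
    then have "conn (U - insert u {})"
      by (intro connI_root[where r = r] reach) (auto simp: P_def)
    then show False using uc by simp
  qed
  moreover have "conn (U - insert u P)"
    by (intro connI_root[where r = r] reach) (auto simp: P_def)
  moreover have "u \<notin> P" using u(3) by (auto simp: P_def L_def)
  moreover have "P \<subseteq> U" by (auto simp: P_def L_def)
  moreover have "adj s z \<longleftrightarrow> z = u" if "s \<in> P" "z \<in> U" for s z
  proof -
    have s: "s \<in> U" "dst U r s = dst U r v" using that by (auto simp: P_def L_def)
    then have "r \<noteq> s" using \<open>0 < dst U r v\<close> by auto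
    then obtain w where "w \<in> U" "adj w s" using dst_predecessor[OF assms(2) r(1) s(1)] by blast
    moreover have "\<forall>y\<in>U. adj s y \<longrightarrow> y = u" using that by (simp add: P_def)
    ultimately show ?thesis using that adj_sym by metis
  qed
  moreover have "x \<in> U - insert u P" using x u by (auto simp: P_def L_def)
  ultimately show ?thesis using that u(1) x(2) by blast
qed

section \<open>The sum of distances with multiplicities\<close>

text \<open>Induction on \<open>U\<close> with the index set \<open>I\<close> fixed, as copies are
  moved but never discarded. Providing the set \<open>S\<close> itself lets it be extended by
  \<open>P\<close>; each added vertex raises the bound by \<open>n\<^sup>2 - n\<close> with
  \<open>n = card I\<close>, exactly the loss allowed by \<open>collapse_pendants\<close>.\<close>

lemma sum_cdist_le:
  fixes f :: "'i \<Rightarrow> 'a"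
  assumes "finite U" "U \<noteq> {}" "conn U" "finite I" "f ` I = U"
  shows "\<exists>S\<subseteq>U. indep S \<and> (\<Sum>i\<in>I. \<Sum>k\<in>I. cdist U (f i) (f k))
    \<le> int (card S) * (int (card I))\<^sup>2 - (int (card S) - 1) * int (card I)"
  using assms
proof (induction "card U" arbitrary: U f rule: less_induct)
  case less
  have "card U \<noteq> 0" using less.prems(1,2) by simp
  then consider "card U = 1"
    | u v where "u \<in> U" "v \<in> U" "adj u v" "conn (U - {u})" "conn (U - {v})"
    | "card U \<ge> 2" "\<forall>u\<in>U. \<forall>v\<in>U. adj u v \<longrightarrow> conn (U - {u}) \<longrightarrow> \<not> conn (U - {v})"
    by (metis One_nat_def Suc_1 Suc_leI le_neq_implies_less neq0_conv)
  then show ?case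
  proof cases
    case 1
    then obtain x where "U = {x}" by (auto simp: card_1_singleton_iff)
    then have "f i = x" if "i \<in> I" for i using that less.prems by auto
    then have "(\<Sum>i\<in>I. \<Sum>k\<in>I. cdist U (f i) (f k)) = (int (card I))\<^sup>2"
      by (simp add: power2_eq_square)
    then show ?thesis using \<open>U = {x}\<close>
      by (intro exI[of _ "{x}"]) (auto simp: indep_def adj_irrefl)
  next
    case (2 u v)
    \<comment> \<open>Proved for either order of the two vertices, so that copies can be moved
      towards the one with the larger distance sum.\<close>
    have *: ?thesis if uv: "u \<in> U" "v \<in> U" "adj u v" "conn (U - {v})"
      and le: "(\<Sum>k\<in>I. cdist U v (f k)) \<le> (\<Sum>k\<in>I. cdist U u (f k))" for u v
    proof -
      define g where "g i = (if f i = v then u else f i)" for i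
      have "u \<noteq> v" using uv adj_irrefl by blast
      have "card (U - {v}) < card U" using uv less.prems(1) by (intro psubset_card_mono) auto
      moreover have "g ` I = (\<lambda>y. if y = v then u else y) ` U"
        unfolding less.prems(5)[symmetric] image_image g_def ..
      then have "g ` I = U - {v}" using uv \<open>u \<noteq> v\<close> by (auto split: if_splits)
      moreover have "U - {v} \<noteq> {}" using uv \<open>u \<noteq> v\<close> by auto
      ultimately obtain S where "S \<subseteq> U - {v}" "indep S"
        "(\<Sum>i\<in>I. \<Sum>k\<in>I. cdist (U - {v}) (g i) (g k))
          \<le> int (card S) * (int (card I))\<^sup>2 - (int (card S) - 1) * int (card I)"
        using less.hyps[of "U - {v}" g] uv less.prems by blast
      moreover have "(\<Sum>i\<in>I. \<Sum>k\<in>I. cdist U (f i) (f k))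
          \<le> (\<Sum>i\<in>I. \<Sum>k\<in>I. cdist (U - {v}) (g i) (g k))"
        unfolding g_def by (rule merge_adjacent) (use uv le less.prems in auto)
      ultimately show ?thesis by (meson Diff_subset order_trans)
    qed
    show ?thesis
    proof (cases "(\<Sum>k\<in>I. cdist U v (f k)) \<le> (\<Sum>k\<in>I. cdist U u (f k))")
      case True
      then show ?thesis using *[OF 2(1-3,5)] by blast
    next
      case False
      then show ?thesis by (intro *[OF 2(2,1) adj_sym[OF 2(3)] 2(4)]) linarith
    qed
  next
    case 3
    obtain u P x where P: "u \<in> U" "P \<subseteq> U" "P \<noteq> {}" "u \<notin> P"
      "\<forall>s\<in>P. \<forall>z\<in>U. adj s z \<longleftrightarrow> z = u"
      "conn (U - insert u P)" "x \<in> U - insert u P" "adj x u"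
      by (rule ex_pendants[OF less.prems(1,3) 3]) (rule that)
    define U' where "U' = U - insert u P"
    define g where "g i = (if f i \<in> insert u P then x else f i)" for i
    have "finite P" using P(2) less.prems(1) by (rule finite_subset)
    have "card U' < card U" unfolding U'_def using P(1) less.prems(1) by (intro psubset_card_mono) auto
    moreover have "g ` I = (\<lambda>y. if y \<in> insert u P then x else y) ` U"
      unfolding less.prems(5)[symmetric] image_image g_def ..
    then have "g ` I = U'" using P(1,7) by (auto simp: U'_def split: if_splits)
    moreover have "U' \<noteq> {}" "finite U'" "conn U'" using P less.prems by (auto simp: U'_def)
    ultimately obtain S where S: "S \<subseteq> U'" "indep S"
      "(\<Sum>i\<in>I. \<Sum>k\<in>I. cdist U' (g i) (g k))
        \<le> int (card S) * (int (card I))\<^sup>2 - (int (card S) - 1) * int (card I)"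
      using less.hyps[of U' g] less.prems(4) by blast
    have "(\<Sum>i\<in>I. \<Sum>k\<in>I. cdist U (f i) (f k)) \<le>
        (\<Sum>i\<in>I. \<Sum>k\<in>I. cdist U' (g i) (g k)) + int (card P) * ((int (card I))\<^sup>2 - int (card I))"
      unfolding g_def
      by (rule collapse_pendants[of U U' u P x I f])
         (use P less.prems \<open>finite P\<close> adj_sym in \<open>auto simp: U'_def\<close>)
    moreover have "card (S \<union> P) = card S + card P"
      using S(1) \<open>finite P\<close> \<open>finite U'\<close> finite_subset
      by (intro card_Un_disjoint) (auto simp: U'_def)
    ultimately have "(\<Sum>i\<in>I. \<Sum>k\<in>I. cdist U (f i) (f k))
        \<le> int (card (S \<union> P)) * (int (card I))\<^sup>2 - (int (card (S \<union> P)) - 1) * int (card I)"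
      using S(3) by (simp add: algebra_simps)
    moreover have "indep (S \<union> P)"
    proof -
      \<comment> \<open>The only neighbour of \<open>s\<close> in \<open>U\<close> is
        \<open>u\<close>, which lies neither in \<open>S\<close> nor in \<open>P\<close>.\<close>
      have "\<not> adj s z" if "s \<in> P" "z \<in> S \<union> P" for s z
        using that P(1,2,4,5) S(1) by (auto simp: U'_def)
      then show ?thesis using S(2) adj_sym unfolding indep_def by blast
    qed
    moreover have "S \<union> P \<subseteq> U" using S P by (auto simp: U'_def)
    ultimately show ?thesis by blast
  qed
qed

section \<open>Independent sets along geodesics\<close>

lemma ex_indep_geodesic:
  assumes "conn U" "x \<in> U" "y \<in> U"
  shows "\<exists>S\<subseteq>U. indep S \<and> dst U x y + 1 \<le> 2 * card S"
proof -
  define n where "n = dst U x y"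
  obtain f where f: "f 0 = x" "f n = y" "\<forall>i<n. step U (f i) (f (Suc i))"
    using dst_walk[OF connD[OF assms]] by (auto simp: relpowp_fun_conv n_def)
  have fU: "f i \<in> U" if "i \<le> n" for i
    using that f assms(3) by (cases "i = n") (auto simp: step_def)
  have seg: "(step U ^^ k) (f i) (f (i + k))" if "i + k \<le> n" for i k
    using that f(3) by (auto simp: relpowp_fun_conv intro!: exI[of _ "\<lambda>l. f (i + l)"])
  \<comment> \<open>An initial piece of a shortest walk is itself shortest, so positions are
    distances from \<open>x\<close>. This excludes repeated vertices and chords among the even
    positions.\<close>
  have d: "dst U x (f i) = i" if "i \<le> n" for i
  proof (rule antisym)
    show "dst U x (f i) \<le> i" using dst_le[OF seg[of 0 i]] that f by simp
    have "dst U (f i) y \<le> n - i" using dst_le[OF seg[of i "n - i"]] that f by simp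
    then show "i \<le> dst U x (f i)"
      using dst_triangle[OF assms(1,2) fU[OF that] assms(3)] that by (simp flip: n_def)
  qed
  define S where "S = (\<lambda>i. f (2 * i)) ` {..n div 2}"
  have "inj_on (\<lambda>i. f (2 * i)) {..n div 2}"
  proof (rule inj_onI)
    fix i k assume "i \<in> {..n div 2}" "k \<in> {..n div 2}" "f (2 * i) = f (2 * k)"
    moreover from this have "2 * i \<le> n" "2 * k \<le> n" by auto
    ultimately have "2 * i = 2 * k" using d by metis
    then show "i = k" by simp
  qed
  then have "card S = n div 2 + 1" by (simp add: S_def card_image)
  moreover have "indep S"
  proof -
    have "\<not> adj (f (2 * i)) (f (2 * k))" if "i < k" "k \<le> n div 2" for i k
    proof
      assume "adj (f (2 * i)) (f (2 * k))"
      moreover have le: "2 * i \<le> n" "2 * k \<le> n" using that by auto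
      ultimately have "dst U (f (2 * i)) (f (2 * k)) \<le> 1" using fU by (intro dst_adj_le)
      then have "2 * k \<le> 2 * i + 1"
        using dst_triangle[OF assms(1,2) fU[OF le(1)] fU[OF le(2)]] d[OF le(1)] d[OF le(2)] by linarith
      then show False using that by simp
    qed
    then have "\<not> adj (f (2 * i)) (f (2 * k))" if "i \<le> n div 2" "k \<le> n div 2" for i k
      using that adj_irrefl adj_sym by (metis linorder_less_linear)
    then show ?thesis by (auto simp: indep_def S_def)
  qed
  moreover have "S \<subseteq> U" using fU by (auto simp: S_def)
  ultimately show ?thesis by (intro exI[of _ S]) (auto simp flip: n_def)
qed

end

section \<open>Double counting and convexity\<close>

lemma sum_ordered_pairs:
  fixes g :: "'a set \<Rightarrow> real"
  assumes "finite V"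
  shows "(\<Sum>x\<in>V. \<Sum>y\<in>V - {x}. g {x, y}) = 2 * (\<Sum>e | e \<subseteq> V \<and> card e = 2. g e)"
proof -
  define A where "A = Sigma V (\<lambda>x. V - {x})"
  have fA: "finite A" using assms by (auto simp: A_def)
  have fT: "finite {e. e \<subseteq> V \<and> card e = 2}" using assms by simp
  have im: "(\<lambda>(x, y). {x, y}) ` A \<subseteq> {e. e \<subseteq> V \<and> card e = 2}" by (auto simp: A_def)
  have "(\<Sum>x\<in>V. \<Sum>y\<in>V - {x}. g {x, y}) = (\<Sum>p\<in>A. g (case p of (x, y) \<Rightarrow> {x, y}))"
    unfolding A_def using assms by (subst sum.Sigma) (auto simp: case_prod_beta)
  also have "\<dots> = (\<Sum>e | e \<subseteq> V \<and> card e = 2.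
      \<Sum>p | p \<in> A \<and> (case p of (x, y) \<Rightarrow> {x, y}) = e. g (case p of (x, y) \<Rightarrow> {x, y}))"
    by (rule sum.group[OF fA fT im, symmetric])
  also have "\<dots> = (\<Sum>e | e \<subseteq> V \<and> card e = 2. 2 * g e)"
  proof (rule sum.cong[OF refl])
    fix e assume "e \<in> {e. e \<subseteq> V \<and> card e = 2}"
    then obtain a b where e: "e = {a, b}" "a \<noteq> b" "a \<in> V" "b \<in> V"
      unfolding card_2_iff by blast
    then have "{p. p \<in> A \<and> (case p of (x, y) \<Rightarrow> {x, y}) = e} = {(a, b), (b, a)}"
      by (auto simp: A_def doubleton_eq_iff)
    then show "(\<Sum>p | p \<in> A \<and> (case p of (x, y) \<Rightarrow> {x, y}) = e. g (case p of (x, y) \<Rightarrow> {x, y})) = 2 * g e"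
      using e by (simp add: insert_commute[of b a])
  qed
  finally show ?thesis by (simp add: sum_distrib_left)
qed

text \<open>By convexity the power function lies below its chord between \<open>1\<close> and
  \<open>b\<close>; the right-hand side is that chord at \<open>d\<close>.\<close>

lemma powr_le_chord:
  fixes b d j :: real
  assumes "1 \<le> j" "1 \<le> d" "d \<le> b" "1 < b"
  shows "d powr j \<le> 1 + (d - 1) / (b - 1) * (b powr j - 1)"
proof -
  define t where "t = (d - 1) / (b - 1)"
  have t: "0 \<le> t" "t \<le> 1" using assms by (auto simp: t_def)
  have "(1 - t) * 1 + t * b = 1 + t * (b - 1)" by (simp add: algebra_simps)
  then have "(1 - t) * 1 + t * b = d" using assms by (simp add: t_def)
  then have "d powr j \<le> (1 - t) * 1 + t * b powr j"
    using convex_onD[OF powr_convex[OF assms(1)] t, of 1 b] assms by simp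
  also have "\<dots> = 1 + t * (b powr j - 1)" by (simp add: algebra_simps)
  finally show ?thesis by (simp add: t_def)
qed

section \<open>Transfer to symmetric digraphs\<close>

text \<open>Serves to identify \<open>graph_dist\<close> with \<open>dst\<close> on the whole vertex
  set. Membership of \<open>u\<close> matters for \<open>n = 0\<close>: an empty
  \<open>awalk\<close> starts at a vertex, while the zeroth power relates every element to
  itself.\<close>

lemma (in wf_digraph) ex_awalk_iff_relpowp:
  assumes "u \<in> verts G"
  shows "(\<exists>p. awalk u p v \<and> length p = n) \<longleftrightarrow> ((\<lambda>x y. x \<rightarrow>\<^bsub>G\<^esub> y) ^^ n) u v"
  using assms
proof (induction n arbitrary: u)
  case 0
  then show ?case by (auto simp: awalk_Nil_iff)
next
  case (Suc n)
  have "(\<exists>p. awalk u p v \<and> length p = Suc n) \<longleftrightarrow> (\<exists>a p. awalk u (a # p) v \<and> length p = n)"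
    by (metis length_Cons length_Suc_conv)
  also have "\<dots> \<longleftrightarrow> (\<exists>a\<in>arcs G. tail G a = u \<and> (\<exists>p. awalk (head G a) p v \<and> length p = n))"
    unfolding awalk_Cons_iff by blast
  also have "\<dots> \<longleftrightarrow> (\<exists>a\<in>arcs G. tail G a = u \<and> ((\<lambda>x y. x \<rightarrow>\<^bsub>G\<^esub> y) ^^ n) (head G a) v)"
    using Suc.IH by auto
  also have "\<dots> \<longleftrightarrow> (\<exists>y. u \<rightarrow>\<^bsub>G\<^esub> y \<and> ((\<lambda>x y. x \<rightarrow>\<^bsub>G\<^esub> y) ^^ n) y v)"
    by (auto simp: arcs_ends_conv)
  finally show ?case by (auto simp: relpowp_Suc_left simp del: relpowp.simps)
qed

lemma (in fin_digraph) card_le_independence_number: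
  assumes "independent_set G S"
  shows "card S \<le> independence_number G"
  unfolding independence_number_def
proof (rule Max_ge)
  have "{S. independent_set G S} \<subseteq> Pow (verts G)" by (auto simp: independent_set_def)
  then show "finite (card ` {S. independent_set G S})" by (simp add: finite_subset)
qed (use assms in simp)

context graph
begin

lemma adjacency: "adjacency (\<lambda>u v. u \<rightarrow>\<^bsub>G\<^esub> v)"
proof
  show "v \<rightarrow>\<^bsub>G\<^esub> u" if "u \<rightarrow>\<^bsub>G\<^esub> v" for u v using that by (rule graph_symmetric)
  show "\<not> u \<rightarrow>\<^bsub>G\<^esub> u" for u by (auto simp: arcs_ends_conv dest: no_loops)
qed

interpretation adjacency "\<lambda>u v. u \<rightarrow>\<^bsub>G\<^esub> v"
  by (rule adjacency)

lemma step_verts: "step (verts G) = (\<lambda>u v. u \<rightarrow>\<^bsub>G\<^esub> v)"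
  by (auto simp: step_def fun_eq_iff)

lemma dst_verts: "u \<in> verts G \<Longrightarrow> dst (verts G) u v = graph_dist G u v"
  by (simp add: dst_def graph_dist_def step_verts ex_awalk_iff_relpowp)

lemma independent_set_iff: "independent_set G S \<longleftrightarrow> S \<subseteq> verts G \<and> indep S"
  by (simp add: independent_set_def indep_def)

lemma conn_verts:
  assumes "Digraph_Component.connected G"
  shows "conn (verts G)"
  unfolding conn_def step_verts
proof (intro ballI)
  fix u v assume "u \<in> verts G" "v \<in> verts G"
  then have "u \<rightarrow>\<^sup>*\<^bsub>G\<^esub> v"
    using symmetric_connected_imp_strongly_connected[OF sym_arcs assms]
    unfolding strongly_connected_def by blast
  then have "(u, v) \<in> (arcs_ends G)\<^sup>*" by (rule reachable_rtranclI)
  then show "(\<lambda>u v. u \<rightarrow>\<^bsub>G\<^esub> v)\<^sup>*\<^sup>* u v" by (simp add: rtranclp_rtrancl_eq)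
qed

lemma graph_dist_bounds:
  assumes "Digraph_Component.connected G" "u \<in> verts G" "v \<in> verts G" "u \<noteq> v"
  shows "1 \<le> graph_dist G u v" "graph_dist G u v + 1 \<le> 2 * independence_number G"
proof -
  show "1 \<le> graph_dist G u v"
    using dst_eq_0_iff[OF conn_verts[OF assms(1)] assms(2,3)] assms(4) dst_verts[OF assms(2)] by simp
  obtain S where "S \<subseteq> verts G" "indep S" "graph_dist G u v + 1 \<le> 2 * card S"
    using ex_indep_geodesic[OF conn_verts[OF assms(1)] assms(2,3)] dst_verts[OF assms(2)]
    by auto
  then show "graph_dist G u v + 1 \<le> 2 * independence_number G"
    using card_le_independence_number[of S] by (auto simp: independent_set_iff)
qed

text \<open>Take one copy of each vertex in \<open>sum_cdist_le\<close>: the diagonal contributes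
  \<open>n\<close>, and subtracting it turns the bound into
  \<open>card S * (n * (n - 1))\<close>.\<close>

lemma sum_graph_dist_le:
  assumes "Digraph_Component.connected G" "verts G \<noteq> {}"
  shows "(\<Sum>u\<in>verts G. \<Sum>v\<in>verts G - {u}. real (graph_dist G u v))
    \<le> real (independence_number G) * (real (card (verts G)) * (real (card (verts G)) - 1))"
proof -
  define n where "n = real (card (verts G))"
  obtain S where S: "S \<subseteq> verts G" "indep S" "(\<Sum>u\<in>verts G. \<Sum>v\<in>verts G. cdist (verts G) u v)
      \<le> int (card S) * (int (card (verts G)))\<^sup>2 - (int (card S) - 1) * int (card (verts G))"
    using sum_cdist_le[of "verts G" "verts G" "\<lambda>u. u"] conn_verts[OF assms(1)] assms(2) by auto
  have "(\<Sum>v\<in>verts G. cdist (verts G) u v) = 1 + (\<Sum>v\<in>verts G - {u}. int (graph_dist G u v))"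
    if "u \<in> verts G" for u
  proof -
    have "(\<Sum>v\<in>verts G - {u}. cdist (verts G) u v) = (\<Sum>v\<in>verts G - {u}. int (graph_dist G u v))"
      by (rule sum.cong) (auto simp: cdist_def dst_verts that)
    then show ?thesis using that by (simp add: sum.remove[of _ u])
  qed
  then have "real_of_int (\<Sum>u\<in>verts G. \<Sum>v\<in>verts G. cdist (verts G) u v)
      = n + (\<Sum>u\<in>verts G. \<Sum>v\<in>verts G - {u}. real (graph_dist G u v))"
    by (simp add: sum.distrib n_def)
  moreover have "real_of_int (\<Sum>u\<in>verts G. \<Sum>v\<in>verts G. cdist (verts G) u v)
      \<le> real_of_int (int (card S) * (int (card (verts G)))\<^sup>2 - (int (card S) - 1) * int (card (verts G)))"
    using S(3) by linarith
  ultimately have "(\<Sum>u\<in>verts G. \<Sum>v\<in>verts G - {u}. real (graph_dist G u v))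
      \<le> real (card S) * (n * (n - 1))"
    by (simp add: n_def power2_eq_square algebra_simps)
  also have "\<dots> \<le> real (independence_number G) * (n * (n - 1))"
  proof (rule mult_right_mono)
    show "real (card S) \<le> real (independence_number G)"
      using card_le_independence_number[of S] S by (simp add: independent_set_iff)
    have "1 \<le> n" using assms(2) by (simp add: n_def Suc_leI card_gt_0_iff)
    then show "0 \<le> n * (n - 1)" by simp
  qed
  finally show ?thesis by (simp add: n_def)
qed

end

section \<open>From the mean distance to power means\<close>

theorem theorem9:
  fixes G :: "('a, 'b) pre_digraph" and j :: real
  assumes "j \<ge> 1"
    and "graph G"
    and "Digraph_Component.connected G"
    and "card (verts G) \<ge> 2"
  shows "mean_distance j G \<le> power_mean j {#2 * real (independence_number G) - 1, 1#}
    \<and> power_mean j {#2 * real (independence_number G) - 1, 1#}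
        = (((2 * real (independence_number G) - 1) powr j + 1) / 2) powr (1 / j)"
proof -
  interpret graph G by fact
  define \<alpha> where "\<alpha> = real (independence_number G)"
  define n where "n = real (card (verts G))"
  define E where "E = {e. e \<subseteq> verts G \<and> card e = 2}"
  define M where "M = ((2 * \<alpha> - 1) powr j + 1) / 2"
  have n2: "2 \<le> n" and ne: "verts G \<noteq> {}" using assms(4) by (auto simp: n_def)
  have fE: "finite E" by (simp add: E_def)
  have "(\<Sum>v\<in>verts G - {u}. 1) = n - 1" if "u \<in> verts G" for u
    using that ne by (simp add: n_def card_Diff_singleton Suc_leI card_gt_0_iff of_nat_diff)
  then have cE: "2 * real (card E) = n * (n - 1)"
    using sum_ordered_pairs[OF finite_verts, of "\<lambda>_. 1"] by (simp add: E_def n_def)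
  then have E0: "0 < real (card E)" using n2 by (smt (verit) mult_pos_pos)
  have bounds: "1 \<le> real (pair_dist G e)" "real (pair_dist G e) \<le> 2 * \<alpha> - 1" if "e \<in> E" for e
  proof -
    obtain u v where uv: "e = {u, v}" "u \<noteq> v" "u \<in> verts G" "v \<in> verts G"
      using \<open>e \<in> E\<close> unfolding E_def card_2_iff by blast
    then show "1 \<le> real (pair_dist G e)" "real (pair_dist G e) \<le> 2 * \<alpha> - 1"
      using graph_dist_bounds[OF assms(3) uv(3,4,2)] by (auto simp: pair_dist_eq \<alpha>_def)
  qed
  have "2 * (\<Sum>e\<in>E. real (pair_dist G e)) \<le> \<alpha> * (2 * real (card E))"
    using sum_graph_dist_le[OF assms(3) ne] sum_ordered_pairs[OF finite_verts, of "\<lambda>e. real (pair_dist G e)"]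
    by (simp add: E_def[symmetric] cE n_def[symmetric] \<alpha>_def[symmetric] pair_dist_eq)
  then have mean: "(\<Sum>e\<in>E. real (pair_dist G e)) \<le> \<alpha> * real (card E)" by simp
  have "(\<Sum>e\<in>E. real (pair_dist G e) powr j) \<le> M * real (card E)"
  proof (cases "\<alpha> > 1")
    \<comment> \<open>Here \<open>bounds\<close> forces every distance to be 1. The case is separate
      because the chord would have coinciding endpoints.\<close>
    case False
    then have "real (pair_dist G e) = 1 \<and> 2 * \<alpha> - 1 = 1" if "e \<in> E" for e
      using bounds[OF that] by linarith
    moreover obtain e where "e \<in> E" using E0 by fastforce
    ultimately show ?thesis by (simp add: M_def)
  next
    case True
    \<comment> \<open>The slope of the chord of the power function between \<open>1\<close> and
      \<open>2 * \<alpha> - 1\<close>; its sign lets the bound on the mean be inserted.\<close>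
    define q where "q = ((2 * \<alpha> - 1) powr j - 1) / (2 * \<alpha> - 2)"
    have "1 \<le> (2 * \<alpha> - 1) powr j" using True assms(1) by (simp add: ge_one_powr_ge_zero)
    then have q: "0 \<le> q" using True by (simp add: q_def)
    have "(\<Sum>e\<in>E. real (pair_dist G e) powr j) \<le> (\<Sum>e\<in>E. 1 + q * (real (pair_dist G e) - 1))"
    proof (rule sum_mono)
      fix e assume "e \<in> E"
      then show "real (pair_dist G e) powr j \<le> 1 + q * (real (pair_dist G e) - 1)"
        using powr_le_chord[OF assms(1) bounds[of e]] True by (simp add: q_def mult.commute)
    qed
    also have "\<dots> = real (card E) + q * ((\<Sum>e\<in>E. real (pair_dist G e)) - real (card E))"
      by (simp add: sum.distrib sum_subtractf flip: sum_distrib_left)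
    also have "\<dots> \<le> real (card E) + q * (\<alpha> * real (card E) - real (card E))"
      using mean q by (intro add_left_mono mult_left_mono) auto
    \<comment> \<open>The value \<open>\<alpha>\<close> is the midpoint of \<open>1\<close> and
      \<open>2 * \<alpha> - 1\<close>, so the chord there equals the average \<open>M\<close> of its
      end values.\<close>
    also have "\<dots> = (1 + q * (\<alpha> - 1)) * real (card E)" by (simp add: algebra_simps)
    also have "q * (\<alpha> - 1) = ((2 * \<alpha> - 1) powr j - 1) / 2"
      using True by (simp add: q_def field_simps)
    also have "1 + \<dots> = M" by (simp add: M_def field_simps)
    finally show ?thesis .
  qed
  then have "(\<Sum>e\<in>E. real (pair_dist G e) powr j) / real (card E) \<le> M"
    using E0 by (simp add: divide_le_eq)
  then have "mean_distance j G \<le> M powr (1 / j)"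
    unfolding mean_distance_def power_mean_def distance_mset_def E_def[symmetric]
    using assms(1) by (simp add: image_mset.compositionality o_def sum_unfold_sum_mset[symmetric] powr_mono2 sum_nonneg)
  moreover have "power_mean j {#2 * \<alpha> - 1, 1#} = M powr (1 / j)"
    by (simp add: power_mean_def M_def)
  ultimately show ?thesis by (simp add: \<alpha>_def M_def)
qed

end
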